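(* Let $\Psi\in\mathbb{C}^{2}\otimes\mathbb{C}^{2}\otimes\mathbb{C}^{2}$ be a nonzero vector, and let $C^{(1)},C^{(2)},C^{(3)}$ be its coefficient matrices according to the partitions $1|23$, $2|13$, $3|12$. When $\mathrm{rank}(C^{(1)})=2$, let $w_1,w_2$ be the right singular vectors of $C^{(1)}$ and $W_1,W_2$ the associated $2\times2$ matrices. Then: 1. $\Psi$ belongs to the $000$ class if and only if $\mathrm{rank}(C^{(i)})=1$ for all $i=1,2,3$. 2. $\Psi$ belongs to the $0_{1}\Psi^{+}_{23}$ class if and only if $\mathrm{rank}(C^{(1)})=1$ and $\mathrm{rank}(C^{(k)})=2$ for $k=2,3$. 3. $\Psi$ belongs to the $0_{2}\Psi^{+}_{13}$ class if and only if $\mathrm{rank}(C^{(2)})=1$ and $\mathrm{rank}(C^{(k)})=2$ for $k=1,3$. 4. $\Psi$ belongs to the $0_{3}\Psi^{+}_{12}$ class if and only if $\mathrm{rank}(C^{(3)})=1$ and $\mathrm{rank}(C^{(k)})=2$ for $k=1,2$. 5. $\Psi$ belongs to the $GHZ$ class if and only if $\mathrm{rank}(C^{(i)})=2$ for all $i=1,2,3$ and one of the following occurs: (i) $\mathrm{rank}(W_1)=\mathrm{rank}(W_2)=1$; (ii) $\mathrm{rank}(W_1)=2$, $\mathrm{rank}(W_2)=1$ and $\sigma(W_1^{-1}W_2)$ is non-degenerate; (iii) $\mathrm{rank}(W_2)=2$, $\mathrm{rank}(W_1)=1$ and $\sigma(W_2^{-1}W_1)$ is non-degenerate; (iv) $\mathrm{rank}(W_1)=2$,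 $\mathrm{rank}(W_2)=2$ and $\sigma(W_1^{-1}W_2)$ is non-degenerate. 6. $\Psi$ belongs to the $W$ class if and only if $\mathrm{rank}(C^{(i)})=2$ for all $i=1,2,3$ and one of the following occurs: (i) $\mathrm{rank}(W_1)=2$, $\mathrm{rank}(W_2)=1$ and $\sigma(W_1^{-1}W_2)$ is degenerate; (ii) $\mathrm{rank}(W_1)=1$, $\mathrm{rank}(W_2)=2$ and $\sigma(W_2^{-1}W_1)$ is degenerate; (iii) $\mathrm{rank}(W_1)=2$, $\mathrm{rank}(W_2)=2$ and $\sigma(W_1^{-1}W_2)$ is degenerate.
   Context: $\{e_1,e_2\}$ is the canonical orthonormal basis of $\mathbb{C}^2$. Normalization of states is ignored. Two vectors $\Psi,\bar\Psi\in(\mathbb{C}^2)^{\otimes 3}$ belong to the same (SLOCC) entanglement class if there are invertible linear operators $F^{[1]},F^{[2]},F^{[3]}$ on $\mathbb{C}^2$ with $\bar\Psi=F^{[1]}\otimes F^{[2]}\otimes F^{[3]}(\Psi)$. The named classes are the classes of the following vectors: - $000$: $e_1\otimes e_1\otimes e_1$; - $0_1\Psi^+_{23}$: $e_1\otimes e_1\otimes e_1+e_1\otimes e_2\otimes e_2$; - $0_2\Psi^+_{13}$: $e_1\otimes e_1\otimes e_1+e_2\otimes e_1\otimes e_2$; - $0_3\Psi^+_{12}$: $e_1\otimes e_1\otimes e_1+e_2\otimes e_2\otimes e_1$; - $GHZ$: $e_1\otimes e_1\otimes e_1+e_2\otimes e_2\otimes e_2$; - $W$: $e_1\otimes e_1\otimes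 e_2+e_1\otimes e_2\otimes e_1+e_2\otimes e_1\otimes e_1$. For $\Psi=\sum c_{i_1i_2i_3}\,e_{i_1}\otimes e_{i_2}\otimes e_{i_3}$ the coefficient matrices are $$C^{(1)}=\begin{pmatrix}c_{111}&c_{112}&c_{121}&c_{122}\\c_{211}&c_{212}&c_{221}&c_{222}\end{pmatrix},\quad C^{(2)}=\begin{pmatrix}c_{111}&c_{112}&c_{211}&c_{212}\\c_{121}&c_{122}&c_{221}&c_{222}\end{pmatrix},\quad C^{(3)}=\begin{pmatrix}c_{111}&c_{121}&c_{211}&c_{221}\\c_{112}&c_{122}&c_{212}&c_{222}\end{pmatrix}.$$ Fix any singular value decomposition $C^{(1)}=V\Sigma W^\dagger$ with $V\in U(2)$, $W\in U(4)$, and $\Sigma$ a $2\times4$ diagonal matrix with entries $\sigma_1\ge\sigma_2\ge0$. The right singular vectors are the columns $w_j$ of $W$ with $\sigma_j>0$, regarded as elements of $\mathbb{C}^2\otimes\mathbb{C}^2\cong\mathbb{C}^4$ through the ordered basis $e_1\otimes e_1,\ e_1\otimes e_2,\ e_2\otimes e_1,\ e_2\otimes e_2$. Writing $w_j=e_1\otimes w_{j1}+e_2\otimes w_{j2}$ with $w_{j1},w_{j2}\in\mathbb{C}^2$, the associated matrix is $W_j=[w_{j1}\ w_{j2}]$ (the $2\times 2$ matrix with these columns). $\sigma(A)$ denotes the spectrum of a $2\times2$ matrix $A$; it is non-degenerate if the two eigenvalues of $A$ are distinct and degenerate if they coincide. *)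

theory Defs
  imports "HOL-Analysis.Analysis"
begin

section \<open>Tensors in $\mathbb{C}^2\otimes\mathbb{C}^2\otimes\mathbb{C}^2$\<close>

text \<open>
  A vector of the triple tensor product is represented by its coefficients in the
  basis \<open>e\<^sub>i \<otimes> e\<^sub>j \<otimes> e\<^sub>k\<close>: the coefficient \<open>c\<^sub>i\<^sub>j\<^sub>k\<close> of \<open>\<Psi>\<close> is \<open>\<Psi> $ i $ j $ k\<close>.
\<close>

type_synonym tensor3 = "complex^2^2^2"

definition e :: "2 \<Rightarrow> complex^2" where
  "e i = axis i 1"

definition tprod3 :: "complex^2 \<Rightarrow> complex^2 \<Rightarrow> complex^2 \<Rightarrow> tensor3" where
  "tprod3 u v w = (\<chi> i j k. u $ i * v $ j * w $ k)"

text \<open>The action of \<open>F \<otimes> G \<otimes> H\<close>, with operators on $\mathbb{C}^2$ given by their matrices.\<close>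

definition local_op ::
    "complex^2^2 \<Rightarrow> complex^2^2 \<Rightarrow> complex^2^2 \<Rightarrow> tensor3 \<Rightarrow> tensor3" where
  "local_op F G H \<Psi> =
     (\<chi> a b c. \<Sum>i\<in>UNIV. \<Sum>j\<in>UNIV. \<Sum>k\<in>UNIV. F $ a $ i * G $ b $ j * H $ c $ k * \<Psi> $ i $ j $ k)"

lemma local_op_tprod3:
  "local_op F G H (tprod3 u v w) = tprod3 (F *v u) (G *v v) (H *v w)"
  by (simp add: vec_eq_iff local_op_def tprod3_def matrix_vector_mult_def
        sum_2 algebra_simps)

lemma local_op_add: "local_op F G H (\<Phi> + \<Psi>) = local_op F G H \<Phi> + local_op F G H \<Psi>"
  by (simp add: vec_eq_iff local_op_def sum_2 algebra_simps)

section \<open>SLOCC classes\<close>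

definition slocc_class :: "tensor3 \<Rightarrow> tensor3 set" where
  "slocc_class \<Phi> =
     {\<Psi>. \<exists>F G H. invertible F \<and> invertible G \<and> invertible H \<and> \<Psi> = local_op F G H \<Phi>}"

definition class_000 :: "tensor3 set" where
  "class_000 = slocc_class (tprod3 (e 1) (e 1) (e 1))"

definition class_01_Psi23 :: "tensor3 set" where
  "class_01_Psi23 = slocc_class (tprod3 (e 1) (e 1) (e 1) + tprod3 (e 1) (e 2) (e 2))"

definition class_02_Psi13 :: "tensor3 set" where
  "class_02_Psi13 = slocc_class (tprod3 (e 1) (e 1) (e 1) + tprod3 (e 2) (e 1) (e 2))"

definition class_03_Psi12 :: "tensor3 set" where
  "class_03_Psi12 = slocc_class (tprod3 (e 1) (e 1) (e 1) + tprod3 (e 2) (e 2) (e 1))"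

definition class_GHZ :: "tensor3 set" where
  "class_GHZ = slocc_class (tprod3 (e 1) (e 1) (e 1) + tprod3 (e 2) (e 2) (e 2))"

definition class_W :: "tensor3 set" where
  "class_W = slocc_class
     (tprod3 (e 1) (e 1) (e 2) + tprod3 (e 1) (e 2) (e 1) + tprod3 (e 2) (e 1) (e 1))"

section \<open>Coefficient matrices\<close>

definition C1 :: "tensor3 \<Rightarrow> complex^4^2" where
  "C1 \<Psi> = vector
    [vector [\<Psi>$1$1$1, \<Psi>$1$1$2, \<Psi>$1$2$1, \<Psi>$1$2$2],
     vector [\<Psi>$2$1$1, \<Psi>$2$1$2, \<Psi>$2$2$1, \<Psi>$2$2$2]]"

definition C2 :: "tensor3 \<Rightarrow> complex^4^2" where
  "C2 \<Psi> = vector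
    [vector [\<Psi>$1$1$1, \<Psi>$1$1$2, \<Psi>$2$1$1, \<Psi>$2$1$2],
     vector [\<Psi>$1$2$1, \<Psi>$1$2$2, \<Psi>$2$2$1, \<Psi>$2$2$2]]"

definition C3 :: "tensor3 \<Rightarrow> complex^4^2" where
  "C3 \<Psi> = vector
    [vector [\<Psi>$1$1$1, \<Psi>$1$2$1, \<Psi>$2$1$1, \<Psi>$2$2$1],
     vector [\<Psi>$1$1$2, \<Psi>$1$2$2, \<Psi>$2$1$2, \<Psi>$2$2$2]]"

lemma vector_4 [simp]:
  "(vector [a, b, c, d] :: 'a::zero^4) $ 1 = a"
  "(vector [a, b, c, d] :: 'a::zero^4) $ 2 = b"
  "(vector [a, b, c, d] :: 'a::zero^4) $ 3 = c"
  "(vector [a, b, c, d] :: 'a::zero^4) $ 4 = d"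
  by (simp_all add: vector_def)

section \<open>Singular value decomposition\<close>

definition conj_transpose :: "complex^'n^'m \<Rightarrow> complex^'m^'n" where
  "conj_transpose A = (\<chi> i j. cnj (A $ j $ i))"

definition unitary :: "complex^'n^'n \<Rightarrow> bool" where
  "unitary U \<longleftrightarrow> conj_transpose U ** U = mat 1 \<and> U ** conj_transpose U = mat 1"

definition is_svd ::
    "complex^4^2 \<Rightarrow> complex^2^2 \<Rightarrow> real \<Rightarrow> real \<Rightarrow> complex^4^4 \<Rightarrow> bool" where
  "is_svd C V s1 s2 W \<longleftrightarrow>
     unitary V \<and> unitary W \<and> s1 \<ge> s2 \<and> s2 \<ge> 0 \<and>
     C = V ** vector [vector [complex_of_real s1, 0, 0, 0],
                      vector [0, complex_of_real s2, 0, 0]] ** conj_transpose W"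

text \<open>
  The right singular vectors are the columns of \<open>W\<close> belonging to positive singular values.
  When the matrix has rank 2 both singular values are positive, so they are columns 1 and 2.
\<close>

lemma is_svd_rank_2_pos:
  assumes "is_svd C V s1 s2 W" and "rank C = 2"
  shows "s1 > 0" and "s2 > 0"
proof -
  show s2: "s2 > 0"
  proof (rule ccontr)
    assume "\<not> s2 > 0"
    with assms have "s2 = 0" by (simp add: is_svd_def)
    then have *: "C $ i $ j = (V $ i $ 1 * complex_of_real s1) * conj_transpose W $ 1 $ j" for i j
      using assms by (simp add: is_svd_def matrix_matrix_mult_def sum_2 sum_4)
    have "row i C = (V $ i $ 1 * complex_of_real s1) *s row 1 (conj_transpose W)" for i
      by (simp add: vec_eq_iff row_def *)
    then have "rows C \<subseteq> vec.span {row 1 (conj_transpose W)}"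
      by (auto simp: rows_def vec.span_singleton)
    then have "vec.dim (rows C) \<le> card {row 1 (conj_transpose W)}"
      by (rule vec.dim_le_card) simp
    with assms show False by (simp add: row_rank_def_gen)
  qed
  with assms show "s1 > 0" by (simp add: is_svd_def)
qed

text \<open>
  The matrix \<open>[x\<^sub>1 x\<^sub>2]\<close> of a vector \<open>w = e\<^sub>1 \<otimes> x\<^sub>1 + e\<^sub>2 \<otimes> x\<^sub>2\<close>, where \<open>w\<close> is given by its coordinates
  in the ordered basis \<open>e\<^sub>1 \<otimes> e\<^sub>1, e\<^sub>1 \<otimes> e\<^sub>2, e\<^sub>2 \<otimes> e\<^sub>1, e\<^sub>2 \<otimes> e\<^sub>2\<close>.
\<close>

definition assoc_matrix :: "complex^4 \<Rightarrow> complex^2^2" where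
  "assoc_matrix w = vector [vector [w $ 1, w $ 3],
                            vector [w $ 2, w $ 4]]"

definition tprod2 :: "complex^2 \<Rightarrow> complex^2 \<Rightarrow> complex^4" where
  "tprod2 u v = vector [u$1 * v$1, u$1 * v$2, u$2 * v$1, u$2 * v$2]"

lemma assoc_matrix_columns:
  "w = tprod2 (e 1) (column 1 (assoc_matrix w)) + tprod2 (e 2) (column 2 (assoc_matrix w))"
  by (simp add: vec_eq_iff forall_4 tprod2_def e_def axis_def column_def assoc_matrix_def)

section \<open>Spectrum\<close>

definition spectrum :: "complex^2^2 \<Rightarrow> complex set" where
  "spectrum A = {l. \<exists>v. v \<noteq> 0 \<and> A *v v = l *s v}"

definition nondegenerate_spectrum :: "complex^2^2 \<Rightarrow> bool" where
  "nondegenerate_spectrum A \<longleftrightarrow> (\<exists>l m. l \<noteq> m \<and> spectrum A = {l, m})"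

definition degenerate_spectrum :: "complex^2^2 \<Rightarrow> bool" where
  "degenerate_spectrum A \<longleftrightarrow> (\<exists>l. spectrum A = {l})"

end

(*
Call a tensor degenerate in a tensor factor if a nonzero functional on that factor contracts it to
zero; for a nonzero tensor this means that the corresponding coefficient matrix has rank 1. A tensor
degenerate in some factor is a product u (x) M, and det M decides between the class 000 and a
biseparable class. Otherwise the two slices A, B of the tensor span a pencil whose form
det (x A + y B) has a discriminant (the hyperdeterminant). If it is nonzero, the two projective roots
give two rank-one slices and a GHZ decomposition; if it is zero, the slice at the double root is
some c (x) d to which the other slice is tangent, M = c (x) u + a (x) d, and this is a W decomposition.
The classes are separated by SLOCC invariance of degeneracy and by the hyperdeterminants of
these decompositions. A singular value decomposition only changes the basis of the pencil to
conj W1, conj W2, so the discriminant of det (x W1 + y W2) decides, and for invertible W1 it is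
det W1 ^ 2 times the discriminant of the characteristic polynomial of W1^-1 W2.
*)

theory Submission
  imports Defs
begin

section \<open>Ranks of matrices with two rows\<close>

lemma vec2_eq_0_iff: "x = 0 \<longleftrightarrow> x $ 1 = 0 \<and> x $ 2 = 0" for x :: "'a::zero^2"
  by (simp add: vec_eq_iff forall_2)

lemma rows_2: "rows A = {A $ 1, A $ 2}" for A :: "'a^'n^2"
  by (auto simp: rows_def row_def vec_eq_iff) (metis exhaust_2 vec_nth_inverse vec_lambda_eta)+

lemma rank_le_2: "rank A \<le> 2" for A :: "'a::field^'n^2"
proof -
  have "vec.dim (rows A) \<le> card {A $ 1, A $ 2}"
    unfolding rows_2 by (rule vec.dim_le_card) (auto intro: vec.span_base)
  also have "\<dots> \<le> 2"
    by (simp add: card_insert_if)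
  finally show ?thesis
    by (simp add: row_rank_def_gen)
qed

lemma rank_eq_0_iff: "rank A = 0 \<longleftrightarrow> A = 0" for A :: "'a::field^'n^2"
  unfolding row_rank_def_gen vec.dim_eq_0 rows_2 by (auto simp: vec2_eq_0_iff)

text \<open>Independence is phrased through coefficients because \<open>rows A\<close> is a set: two
  equal rows would collapse to one vector, which may well be independent.\<close>

lemma rank_eq_2_iff:
  fixes A :: "'a::field^'n^2"
  shows "rank A = 2 \<longleftrightarrow> (\<forall>x y. x *s A $ 1 + y *s A $ 2 = 0 \<longrightarrow> x = 0 \<and> y = 0)"
proof
  assume r: "rank A = 2"
  show "\<forall>x y. x *s A $ 1 + y *s A $ 2 = 0 \<longrightarrow> x = 0 \<and> y = 0"
  proof (rule ccontr)
    assume "\<not> ?thesis"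
    then obtain x y where xy: "x *s A $ 1 + y *s A $ 2 = 0" "x \<noteq> 0 \<or> y \<noteq> 0"
      by blast
    have "\<exists>v. rows A \<subseteq> vec.span {v}"
    proof (cases "x = 0")
      case True
      with xy have "A $ 2 = 0" by simp
      then show ?thesis
        unfolding rows_2 by (metis insertCI insert_subset empty_subsetI vec.span_base vec.span_zero)
    next
      case False
      have "A $ 1 $ i = (- y / x) * A $ 2 $ i" for i
        using arg_cong[OF xy(1), of "\<lambda>v. v $ i"] False
        by (simp add: field_simps add_eq_0_iff)
      then have "A $ 1 = (- y / x) *s A $ 2"
        by (simp add: vec_eq_iff)
      then have "A $ 1 \<in> vec.span {A $ 2}"
        by (metis vec.span_base vec.span_scale insertI1)
      then show ?thesis
        unfolding rows_2 by (meson insertI1 insert_subset empty_subsetI vec.span_base)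
    qed
    then obtain v where "rows A \<subseteq> vec.span {v}" by blast
    then have "vec.dim (rows A) \<le> card {v}"
      by (rule vec.dim_le_card) simp
    with r show False by (simp add: row_rank_def_gen)
  qed
next
  assume ind: "\<forall>x y. x *s A $ 1 + y *s A $ 2 = 0 \<longrightarrow> x = 0 \<and> y = 0"
  have 1: "A $ 1 \<notin> vec.span {A $ 2}"
  proof
    assume "A $ 1 \<in> vec.span {A $ 2}"
    then obtain k where "A $ 1 = k *s A $ 2" by (auto simp: vec.span_singleton)
    then show False using ind[rule_format, of 1 "-k"] by simp
  qed
  have 2: "A $ 2 \<noteq> 0"
    using ind[rule_format, of 0 1] by auto
  have ne: "A $ 1 \<noteq> A $ 2" using 1 by (auto intro: vec.span_base)
  have "vec.independent {A $ 1, A $ 2}"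
    using 1 2 ne by (simp add: vec.independent_insert)
  then show "rank A = 2"
    unfolding row_rank_def_gen rows_2 using ne by (simp add: vec.dim_eq_card_independent)
qed

lemma rank_eq_2_iff_det: "rank A = 2 \<longleftrightarrow> det A \<noteq> 0" for A :: "'a::field^2^2"
proof
  assume r: "rank A = 2"
  show "det A \<noteq> 0"
  proof
    assume d: "det A = 0"
    \<comment> \<open>In general these combinations are, up to sign, \<open>det A\<close> times unit
      vectors. Their coefficients are, up to sign, all four entries of \<open>A\<close>, so
      independent rows would force \<open>A = 0\<close>.\<close>
    have "A $ 2 $ 2 *s A $ 1 + (- A $ 1 $ 2) *s A $ 2 = 0"
         "A $ 2 $ 1 *s A $ 1 + (- A $ 1 $ 1) *s A $ 2 = 0"
      using d by (auto simp: vec2_eq_0_iff det_2 algebra_simps)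
    with r[unfolded rank_eq_2_iff] have "A = 0" 
      by (metis neg_equal_0_iff_equal vec2_eq_0_iff)
    with r show False using rank_eq_0_iff[of A] by simp
  qed
next
  assume d: "det A \<noteq> 0"
  show "rank A = 2"
    unfolding rank_eq_2_iff
  proof (intro allI impI)
    fix x y assume "x *s A $ 1 + y *s A $ 2 = 0"
    then have e: "x * A $ 1 $ 1 + y * A $ 2 $ 1 = 0" "x * A $ 1 $ 2 + y * A $ 2 $ 2 = 0"
      by (simp_all add: vec2_eq_0_iff)
    \<comment> \<open>Cramer's rule: eliminating the other unknown leaves \<open>det A\<close> as
      coefficient.\<close>
    have "x * det A = 0" "y * det A = 0"
      using e unfolding det_2 by algebra+
    with d show "x = 0 \<and> y = 0" by simp
  qed
qed

section \<open>Degeneracy in a tensor factor and permutations of the factors\<close>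

definition contract :: "complex^2 \<Rightarrow> tensor3 \<Rightarrow> complex^2^2" where
  "contract x \<Psi> = (\<chi> j k. x $ 1 * \<Psi> $ 1 $ j $ k + x $ 2 * \<Psi> $ 2 $ j $ k)"

definition degenerate1 :: "tensor3 \<Rightarrow> bool" where
  "degenerate1 \<Psi> \<longleftrightarrow> (\<exists>x. x \<noteq> 0 \<and> contract x \<Psi> = 0)"

text \<open>\<open>swap12\<close> and \<open>rotate3\<close> bring the second and the third factor
  to the front and leave the other two in the column order of \<open>C2\<close> and
  \<open>C3\<close>. Results about the first factor thereby transfer to all factors.\<close>

definition swap12 :: "tensor3 \<Rightarrow> tensor3" where
  "swap12 \<Psi> = (\<chi> j i k. \<Psi> $ i $ j $ k)"

definition rotate3 :: "tensor3 \<Rightarrow> tensor3" where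
  "rotate3 \<Psi> = (\<chi> k i j. \<Psi> $ i $ j $ k)"

text \<open>The coefficients of a linear relation between the two rows are the coordinates of a
  functional that annihilates \<open>\<Psi>\<close>.\<close>

lemma rank_C1_eq_2_iff: "rank (C1 \<Psi>) = 2 \<longleftrightarrow> \<not> degenerate1 \<Psi>"
proof -
  have *: "x *s C1 \<Psi> $ 1 + y *s C1 \<Psi> $ 2 = 0 \<longleftrightarrow> contract (vector [x, y]) \<Psi> = 0" for x y
    by (auto simp: vec_eq_iff forall_4 forall_2 C1_def contract_def)
  have "vector [z $ 1, z $ 2] = z" for z :: "complex^2"
    by (simp add: vec_eq_iff forall_2)
  then show ?thesis
    unfolding rank_eq_2_iff degenerate1_def * 
    by (metis vec2_eq_0_iff vector_2)
qed

lemma rank_C1_eq_0_iff: "rank (C1 \<Psi>) = 0 \<longleftrightarrow> \<Psi> = 0"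
  by (auto simp: rank_eq_0_iff vec_eq_iff forall_2 forall_4 C1_def)

lemma rank_C1_eq_1_iff: "\<Psi> \<noteq> 0 \<Longrightarrow> rank (C1 \<Psi>) = 1 \<longleftrightarrow> degenerate1 \<Psi>"
  using rank_C1_eq_0_iff[of \<Psi>] rank_C1_eq_2_iff[of \<Psi>] rank_le_2[of "C1 \<Psi>"] by linarith

lemma C2_conv_C1: "C2 \<Psi> = C1 (swap12 \<Psi>)"
  by (simp add: C1_def C2_def swap12_def)

lemma C3_conv_C1: "C3 \<Psi> = C1 (rotate3 \<Psi>)"
  by (simp add: C1_def C3_def rotate3_def)

lemma swap12_swap12 [simp]: "swap12 (swap12 \<Psi>) = \<Psi>"
  by (simp add: swap12_def vec_eq_iff)

lemma rotate3_rotate3_rotate3 [simp]: "rotate3 (rotate3 (rotate3 \<Psi>)) = \<Psi>"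
  by (simp add: rotate3_def vec_eq_iff)

lemma swap12_0 [simp]: "swap12 0 = 0" and rotate3_0 [simp]: "rotate3 0 = 0"
  by (simp_all add: swap12_def rotate3_def vec_eq_iff)

lemma swap12_eq_0_iff [simp]: "swap12 \<Psi> = 0 \<longleftrightarrow> \<Psi> = 0"
  by (metis swap12_0 swap12_swap12)

lemma rotate3_eq_0_iff [simp]: "rotate3 \<Psi> = 0 \<longleftrightarrow> \<Psi> = 0"
  by (metis rotate3_0 rotate3_rotate3_rotate3)

lemma swap12_tprod3: "swap12 (tprod3 u v w) = tprod3 v u w"
  by (simp add: swap12_def tprod3_def vec_eq_iff)

lemma rotate3_tprod3: "rotate3 (tprod3 u v w) = tprod3 w u v"
  by (simp add: rotate3_def tprod3_def vec_eq_iff)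

lemma swap12_add: "swap12 (\<Phi> + \<Psi>) = swap12 \<Phi> + swap12 \<Psi>"
  by (simp add: swap12_def vec_eq_iff)

lemma rotate3_add: "rotate3 (\<Phi> + \<Psi>) = rotate3 \<Phi> + rotate3 \<Psi>"
  by (simp add: rotate3_def vec_eq_iff)

lemma swap12_local_op: "swap12 (local_op F G H \<Psi>) = local_op G F H (swap12 \<Psi>)"
  by (simp add: swap12_def local_op_def vec_eq_iff sum_2 algebra_simps)

lemma rotate3_local_op: "rotate3 (local_op F G H \<Psi>) = local_op H F G (rotate3 \<Psi>)"
  by (simp add: rotate3_def local_op_def vec_eq_iff sum_2 algebra_simps)

section \<open>SLOCC equivalence and the invariance of degeneracy\<close>

lemma slocc_class_swap: "\<Psi> \<in> slocc_class \<Phi> \<Longrightarrow> swap12 \<Psi> \<in> slocc_class (swap12 \<Phi>)"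
  unfolding slocc_class_def using swap12_local_op by blast

lemma slocc_class_rotate: "\<Psi> \<in> slocc_class \<Phi> \<Longrightarrow> rotate3 \<Psi> \<in> slocc_class (rotate3 \<Phi>)"
  unfolding slocc_class_def using rotate3_local_op by blast

lemma local_op_local_op:
  "local_op F G H (local_op F' G' H' \<Psi>) = local_op (F ** F') (G ** G') (H ** H') \<Psi>"
  by (simp add: local_op_def matrix_matrix_mult_def vec_eq_iff sum_2 algebra_simps)

lemma local_op_id: "local_op (mat 1) (mat 1) (mat 1) \<Psi> = \<Psi>"
  unfolding local_op_def vec_eq_iff forall_2 sum_2 mat_def by simp

lemma
  fixes A :: "'a::semiring_1^'n^'n"
  assumes "invertible A"
  shows matrix_inv_right: "A ** matrix_inv A = mat 1"
    and matrix_inv_left: "matrix_inv A ** A = mat 1"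
    and invertible_matrix_inv: "invertible (matrix_inv A)"
proof -
  show "A ** matrix_inv A = mat 1" "matrix_inv A ** A = mat 1"
    using someI_ex[OF assms[unfolded invertible_def]] unfolding matrix_inv_def by blast+
  then show "invertible (matrix_inv A)"
    unfolding invertible_def by blast
qed

lemma slocc_class_sym:
  assumes "\<Psi> \<in> slocc_class \<Phi>"
  shows "\<Phi> \<in> slocc_class \<Psi>"
proof -
  obtain F G H where inv: "invertible F" "invertible G" "invertible H" and \<Psi>: "\<Psi> = local_op F G H \<Phi>"
    using assms unfolding slocc_class_def by blast
  have "\<Phi> = local_op (matrix_inv F) (matrix_inv G) (matrix_inv H) \<Psi>"
    unfolding \<Psi> local_op_local_op using inv by (simp add: matrix_inv_left local_op_id)
  then show ?thesis
    unfolding slocc_class_def using inv invertible_matrix_inv by blast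
qed

text \<open>The operator on the contracted factor moves to the functional; the other two only
  multiply the remaining matrix, so a vanishing contraction stays zero.\<close>

lemma contract_local_op:
  "contract x (local_op F G H \<Psi>) = G ** contract (x v* F) \<Psi> ** transpose H"
  by (simp add: contract_def local_op_def vec_eq_iff matrix_matrix_mult_def transpose_def
      vector_matrix_mult_def sum_2 algebra_simps)

lemma slocc_class_degenerate1:
  assumes "\<Psi> \<in> slocc_class \<Phi>"
  shows "degenerate1 \<Psi> \<longleftrightarrow> degenerate1 \<Phi>"
proof -
  have *: "degenerate1 \<Psi>" if cls: "\<Psi> \<in> slocc_class \<Phi>" and deg: "degenerate1 \<Phi>" for \<Phi> \<Psi>
  proof -
    obtain F G H where F: "invertible F" and \<Psi>: "\<Psi> = local_op F G H \<Phi>"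
      using cls unfolding slocc_class_def by blast
    obtain x where x: "x \<noteq> 0" "contract x \<Phi> = 0"
      using deg by (auto simp: degenerate1_def)
    obtain F' where F': "F' ** F = mat 1"
      using F by (auto simp: invertible_def)
    \<comment> \<open>\<open>x v* F'\<close> is the functional that annihilates
      \<open>\<Psi>\<close>: passing through \<open>F\<close> turns it back into
      \<open>x\<close>.\<close>
    have xF: "(x v* F') v* F = x"
      by (simp add: vector_matrix_mul_assoc F')
    then have "contract (x v* F') \<Psi> = 0"
      unfolding \<Psi> contract_local_op xF x by simp
    moreover have "x v* F' \<noteq> 0"
      using xF x by auto
    ultimately show ?thesis by (auto simp: degenerate1_def)
  qed
  show ?thesis using *[of \<Psi> \<Phi>] *[of \<Phi> \<Psi>] assms slocc_class_sym by blast
qed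

section \<open>Pencils of slices, discriminants and rank-one matrices\<close>

text \<open>\<open>det (x A + y B) = det A x\<^sup>2 + mixed_det A B x y + det B y\<^sup>2\<close>; the discriminant of this form
  for the two slices of a tensor is Cayley's hyperdeterminant.\<close>

definition mixed_det :: "complex^2^2 \<Rightarrow> complex^2^2 \<Rightarrow> complex" where
  "mixed_det A B = A$1$1 * B$2$2 + B$1$1 * A$2$2 - A$1$2 * B$2$1 - B$1$2 * A$2$1"

definition pencil_disc :: "complex^2^2 \<Rightarrow> complex^2^2 \<Rightarrow> complex" where
  "pencil_disc A B = mixed_det A B ^ 2 - 4 * det A * det B"

definition hyperdet :: "tensor3 \<Rightarrow> complex" where
  "hyperdet \<Psi> = pencil_disc (\<Psi> $ 1) (\<Psi> $ 2)"

definition tens :: "complex^2 \<Rightarrow> complex^2^2 \<Rightarrow> tensor3" where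
  "tens u M = (\<chi> i j k. u $ i * M $ j $ k)"

definition outer :: "complex^2 \<Rightarrow> complex^2 \<Rightarrow> complex^2^2" where
  "outer u v = (\<chi> j k. u $ j * v $ k)"

text \<open>The determinant with columns \<open>u\<close> and \<open>v\<close>; being nonzero
  expresses that they form a basis.\<close>

definition wedge :: "complex^2 \<Rightarrow> complex^2 \<Rightarrow> complex" where
  "wedge u v = u $ 1 * v $ 2 - u $ 2 * v $ 1"

lemma tens_outer: "tens u (outer v w) = tprod3 u v w"
  by (simp add: tens_def outer_def tprod3_def vec_eq_iff algebra_simps)

lemma tens_add_right: "tens u (M + N) = tens u M + tens u N"
  by (simp add: tens_def vec_eq_iff algebra_simps)

text \<open>The slices arise from \<open>M\<close>, \<open>N\<close> by a change of basis of the
  pencil with determinant \<open>wedge f g\<close>, and the discriminant of a binary quadratic form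
  scales by the square of that determinant.\<close>

lemma hyperdet_tens:
  "hyperdet (tens f M + tens g N) = wedge f g ^ 2 * pencil_disc M N"
  unfolding hyperdet_def pencil_disc_def mixed_det_def det_2 tens_def wedge_def
  by (simp, algebra)

text \<open>Both determinants vanish, and the mixed term factors into the two wedges.\<close>

lemma pencil_disc_outer:
  "pencil_disc (outer a b) (outer c d) = (wedge a c * wedge b d) ^ 2"
  unfolding pencil_disc_def mixed_det_def det_2 outer_def wedge_def
  by (simp, algebra)

text \<open>The first matrix is tangent at \<open>outer a b\<close> to the cone of singular
  matrices, so the pencil form has a double root there.\<close>

lemma pencil_disc_tangent:
  "pencil_disc (outer a d + outer c b) (outer a b) = 0"
  unfolding pencil_disc_def mixed_det_def det_2 outer_def
  by (simp, algebra)

lemma wedge_matrix: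
  assumes "wedge f g \<noteq> 0"
  obtains F where "invertible F" "F *v e 1 = f" "F *v e 2 = g"
proof
  let ?F = "vector [vector [f $ 1, g $ 1], vector [f $ 2, g $ 2]] :: complex^2^2"
  show "invertible ?F"
    using assms by (simp add: invertible_det_nz det_2 wedge_def algebra_simps)
  show "?F *v e 1 = f" "?F *v e 2 = g"
    by (simp_all add: e_def axis_def matrix_vector_mult_def vec_eq_iff forall_2 sum_2)
qed

lemma wedge_mult_vec: "wedge (F *v u) (F *v v) = det F * wedge u v"
  by (simp add: wedge_def det_2 matrix_vector_mult_def sum_2 algebra_simps)

lemma wedge_e [simp]: "wedge (e 1) (e 2) = 1"
  by (simp_all add: wedge_def e_def axis_def)

lemma exists_wedge_ne_0:
  assumes "u \<noteq> 0"
  shows "\<exists>v. wedge u v \<noteq> 0"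
proof (cases "u $ 1 = 0")
  case True
  then have "wedge u (e 1) \<noteq> 0"
    using assms by (simp add: wedge_def e_def axis_def vec2_eq_0_iff)
  then show ?thesis by blast
next
  case False
  then have "wedge u (e 2) \<noteq> 0"
    by (simp add: wedge_def e_def axis_def)
  then show ?thesis by blast
qed

text \<open>A nonzero vector \<open>u\<close> is annihilated by \<open>(u2, -u1)\<close>, and this
  also annihilates every vector dependent on it; if both vectors vanish, any functional will
  do.\<close>

lemma wedge_eq_0E:
  fixes u v :: "complex^2"
  assumes "wedge u v = 0"
  obtains x :: "complex^2" where "x \<noteq> 0" "x $ 1 * u $ 1 + x $ 2 * u $ 2 = 0" "x $ 1 * v $ 1 + x $ 2 * v $ 2 = 0"
proof (cases "u = 0")
  case True
  show ?thesis
  proof (cases "v = 0")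
    case v: True
    show ?thesis by (rule that[of "e 1"]) (use True v in \<open>auto simp: e_def axis_def vec2_eq_0_iff\<close>)
  next
    case False
    then show ?thesis
      by (intro that[of "vector [v $ 2, - v $ 1]"]) (use True in \<open>auto simp: vec2_eq_0_iff\<close>)
  qed
next
  case False
  then show ?thesis
    by (intro that[of "vector [u $ 2, - u $ 1]"])
      (use assms in \<open>auto simp: vec2_eq_0_iff wedge_def algebra_simps\<close>)
qed

text \<open>If the first row is nonzero, the second is a multiple of it, with the factor read off at
  a nonzero entry; otherwise only the second row remains.\<close>

lemma det_eq_0_outerE:
  assumes "det A = 0"
  obtains a b where "A = outer a b"
proof (cases "A $ 1 = 0")
  case True
  then have "A = outer (e 2) (A $ 2)"
    by (simp add: outer_def vec_eq_iff forall_2 e_def axis_def)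
  then show ?thesis by (rule that)
next
  case False
  then consider "A $ 1 $ 1 \<noteq> 0" | "A $ 1 $ 2 \<noteq> 0" by (auto simp: vec2_eq_0_iff)
  then show ?thesis
  proof cases
    case 1
    then have "A = outer (vector [1, A $ 2 $ 1 / A $ 1 $ 1]) (A $ 1)"
      using assms by (simp add: outer_def vec_eq_iff forall_2 det_2 field_simps)
    then show ?thesis by (rule that)
  next
    case 2
    then have "A = outer (vector [1, A $ 2 $ 2 / A $ 1 $ 2]) (A $ 1)"
      using assms by (simp add: outer_def vec_eq_iff forall_2 det_2 field_simps)
    then show ?thesis by (rule that)
  qed
qed

text \<open>\<open>f\<close>, \<open>g\<close> is the basis dual to the functionals
  \<open>x\<close>, \<open>y\<close>, so any basis of functionals can replace the coordinate
  slices.\<close>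

lemma tens_contract:
  assumes "wedge x y \<noteq> 0"
  obtains f g where "wedge f g \<noteq> 0" "\<And>\<Psi>. \<Psi> = tens f (contract x \<Psi>) + tens g (contract y \<Psi>)"
proof
  define d where "d = wedge x y"
  have d: "d \<noteq> 0"
    using assms by (simp add: d_def)
  let ?f = "vector [y $ 2 / d, - y $ 1 / d] :: complex^2"
  let ?g = "vector [- x $ 2 / d, x $ 1 / d] :: complex^2"
  have "wedge ?f ?g = (x $ 1 * y $ 2 - x $ 2 * y $ 1) / (d * d)"
    by (simp add: wedge_def diff_divide_distrib mult.commute)
  then show "wedge ?f ?g \<noteq> 0"
    using d by (simp flip: wedge_def d_def)
  \<comment> \<open>Multiplying by \<open>d\<close> clears the denominators of the dual
    basis.\<close>
  have "d * \<Psi> $ i $ j $ k = d * (tens ?f (contract x \<Psi>) + tens ?g (contract y \<Psi>)) $ i $ j $ k" for \<Psi> i j k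
  proof -
    have "d * \<Psi> $ i $ j $ k =
        (if i = 1 then y $ 2 * contract x \<Psi> $ j $ k - x $ 2 * contract y \<Psi> $ j $ k
         else x $ 1 * contract y \<Psi> $ j $ k - y $ 1 * contract x \<Psi> $ j $ k)"
      using exhaust_2[of i] by (auto simp: d_def wedge_def contract_def algebra_simps)
    also have "\<dots> = d * (tens ?f (contract x \<Psi>) + tens ?g (contract y \<Psi>)) $ i $ j $ k"
      using exhaust_2[of i] d by (elim disjE) (simp_all add: tens_def distrib_left right_diff_distrib)
    finally show ?thesis .
  qed
  then show "\<And>\<Psi>. \<Psi> = tens ?f (contract x \<Psi>) + tens ?g (contract y \<Psi>)"
    unfolding vec_eq_iff mult_left_cancel[OF d] by blast
qed

section \<open>Decompositions that characterise the classes\<close>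

lemma nonzero_matrix:
  fixes u :: "complex^2"
  assumes "u \<noteq> 0"
  obtains F where "invertible F" "F *v e 1 = u"
  using exists_wedge_ne_0[OF assms] wedge_matrix by metis

lemma class_000I: "u \<noteq> 0 \<Longrightarrow> v \<noteq> 0 \<Longrightarrow> w \<noteq> 0 \<Longrightarrow> tprod3 u v w \<in> class_000"
  unfolding class_000_def slocc_class_def mem_Collect_eq
  by (metis nonzero_matrix local_op_tprod3)

lemma class_01I:
  assumes "u \<noteq> 0" "wedge a c \<noteq> 0" "wedge b d \<noteq> 0"
  shows "tprod3 u a b + tprod3 u c d \<in> class_01_Psi23"
proof -
  obtain F where F: "invertible F" "F *v e 1 = u" by (rule nonzero_matrix[OF assms(1)])
  obtain G where G: "invertible G" "G *v e 1 = a" "G *v e 2 = c" by (rule wedge_matrix[OF assms(2)])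
  obtain H where H: "invertible H" "H *v e 1 = b" "H *v e 2 = d" by (rule wedge_matrix[OF assms(3)])
  have "tprod3 u a b + tprod3 u c d = local_op F G H (tprod3 (e 1) (e 1) (e 1) + tprod3 (e 1) (e 2) (e 2))"
    by (simp add: local_op_add local_op_tprod3 F G H)
  then show ?thesis
    unfolding class_01_Psi23_def slocc_class_def using F G H by blast
qed

text \<open>An invertible operator is the same as a basis, namely the images of \<open>e 1\<close>
  and \<open>e 2\<close>. The same argument serves \<open>class_W_iff\<close>.\<close>

lemma class_GHZ_iff:
  "\<Psi> \<in> class_GHZ \<longleftrightarrow> (\<exists>f g a c b d. wedge f g \<noteq> 0 \<and> wedge a c \<noteq> 0 \<and> wedge b d \<noteq> 0 \<and>
     \<Psi> = tprod3 f a b + tprod3 g c d)" (is "_ \<longleftrightarrow> ?R")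
proof
  assume "\<Psi> \<in> class_GHZ"
  then obtain F G H where "invertible F" "invertible G" "invertible H"
    "\<Psi> = local_op F G H (tprod3 (e 1) (e 1) (e 1) + tprod3 (e 2) (e 2) (e 2))"
    unfolding class_GHZ_def slocc_class_def by blast
  then have "\<Psi> = tprod3 (F *v e 1) (G *v e 1) (H *v e 1) + tprod3 (F *v e 2) (G *v e 2) (H *v e 2)"
    "wedge (F *v e 1) (F *v e 2) \<noteq> 0" "wedge (G *v e 1) (G *v e 2) \<noteq> 0"
    "wedge (H *v e 1) (H *v e 2) \<noteq> 0"
    by (simp_all add: local_op_add local_op_tprod3 wedge_mult_vec invertible_det_nz)
  then show ?R by blast
next
  assume ?R
  then obtain f g a c b d where 1: "wedge f g \<noteq> 0" "wedge a c \<noteq> 0" "wedge b d \<noteq> 0"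
    and \<Psi>: "\<Psi> = tprod3 f a b + tprod3 g c d" by blast
  obtain F where F: "invertible F" "F *v e 1 = f" "F *v e 2 = g" by (rule wedge_matrix[OF 1(1)])
  obtain G where G: "invertible G" "G *v e 1 = a" "G *v e 2 = c" by (rule wedge_matrix[OF 1(2)])
  obtain H where H: "invertible H" "H *v e 1 = b" "H *v e 2 = d" by (rule wedge_matrix[OF 1(3)])
  have "\<Psi> = local_op F G H (tprod3 (e 1) (e 1) (e 1) + tprod3 (e 2) (e 2) (e 2))"
    by (simp add: \<Psi> local_op_add local_op_tprod3 F G H)
  then show "\<Psi> \<in> class_GHZ"
    unfolding class_GHZ_def slocc_class_def using F G H by blast
qed

lemma class_W_iff:
  "\<Psi> \<in> class_W \<longleftrightarrow> (\<exists>f g a c b d. wedge f g \<noteq> 0 \<and> wedge a c \<noteq> 0 \<and> wedge b d \<noteq> 0 \<and>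
     \<Psi> = tprod3 f a d + tprod3 f c b + tprod3 g a b)" (is "_ \<longleftrightarrow> ?R")
proof
  assume "\<Psi> \<in> class_W"
  then obtain F G H where "invertible F" "invertible G" "invertible H"
    "\<Psi> = local_op F G H (tprod3 (e 1) (e 1) (e 2) + tprod3 (e 1) (e 2) (e 1) + tprod3 (e 2) (e 1) (e 1))"
    unfolding class_W_def slocc_class_def by blast
  then have "\<Psi> = tprod3 (F *v e 1) (G *v e 1) (H *v e 2) + tprod3 (F *v e 1) (G *v e 2) (H *v e 1)
      + tprod3 (F *v e 2) (G *v e 1) (H *v e 1)"
    "wedge (F *v e 1) (F *v e 2) \<noteq> 0" "wedge (G *v e 1) (G *v e 2) \<noteq> 0"
    "wedge (H *v e 1) (H *v e 2) \<noteq> 0"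
    by (simp_all add: local_op_add local_op_tprod3 wedge_mult_vec invertible_det_nz)
  then show ?R by blast
next
  assume ?R
  then obtain f g a c b d where 1: "wedge f g \<noteq> 0" "wedge a c \<noteq> 0" "wedge b d \<noteq> 0"
    and \<Psi>: "\<Psi> = tprod3 f a d + tprod3 f c b + tprod3 g a b" by blast
  obtain F where F: "invertible F" "F *v e 1 = f" "F *v e 2 = g" by (rule wedge_matrix[OF 1(1)])
  obtain G where G: "invertible G" "G *v e 1 = a" "G *v e 2 = c" by (rule wedge_matrix[OF 1(2)])
  obtain H where H: "invertible H" "H *v e 1 = b" "H *v e 2 = d" by (rule wedge_matrix[OF 1(3)])
  have "\<Psi> = local_op F G H (tprod3 (e 1) (e 1) (e 2) + tprod3 (e 1) (e 2) (e 1) + tprod3 (e 2) (e 1) (e 1))"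
    by (simp add: \<Psi> local_op_add local_op_tprod3 F G H)
  then show "\<Psi> \<in> class_W"
    unfolding class_W_def slocc_class_def using F G H by blast
qed

lemma hyperdet_class_GHZ: "\<Psi> \<in> class_GHZ \<Longrightarrow> hyperdet \<Psi> \<noteq> 0"
  by (auto simp: class_GHZ_iff hyperdet_tens pencil_disc_outer simp flip: tens_outer)

lemma hyperdet_class_W:
  assumes "\<Psi> \<in> class_W"
  shows "hyperdet \<Psi> = 0"
proof -
  obtain f g a c b d where "\<Psi> = tprod3 f a d + tprod3 f c b + tprod3 g a b"
    using assms unfolding class_W_iff by blast
  \<comment> \<open>Grouping by the first factor exhibits a rank-one matrix and a tangent to
    it.\<close>
  then have "\<Psi> = tens f (outer a d + outer c b) + tens g (outer a b)"
    by (simp add: tens_add_right tens_outer)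
  then show ?thesis by (simp add: hyperdet_tens pencil_disc_tangent)
qed

section \<open>Degenerate tensors and singular pencils\<close>

lemma degenerate1_classes:
  assumes "\<Psi> \<noteq> 0" "degenerate1 \<Psi>"
  shows "\<Psi> \<in> class_000 \<union> class_01_Psi23"
proof -
  obtain x where x: "x \<noteq> 0" "contract x \<Psi> = 0"
    using assms(2) by (auto simp: degenerate1_def)
  \<comment> \<open>Completing \<open>x\<close> to a basis of functionals leaves a single product,
    since the contraction with \<open>x\<close> vanishes.\<close>
  obtain y where "wedge x y \<noteq> 0" using exists_wedge_ne_0[OF x(1)] by blast
  then obtain f u where "\<Psi> = tens f (contract x \<Psi>) + tens u (contract y \<Psi>)"
    by (metis tens_contract)
  then have "\<Psi> = tens u (contract y \<Psi>)"
    by (simp add: x) (simp add: tens_def vec_eq_iff)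
  then obtain M where \<Psi>: "\<Psi> = tens u M" by blast
  have u: "u \<noteq> 0" using \<Psi> assms(1) by (auto simp: tens_def vec_eq_iff)
  show ?thesis
  proof (cases "det M = 0")
    case True
    then obtain a b where M: "M = outer a b" by (rule det_eq_0_outerE)
    then have "a \<noteq> 0" "b \<noteq> 0"
      using \<Psi> assms(1) by (auto simp: tens_def outer_def vec_eq_iff)
    then show ?thesis using u class_000I by (simp add: \<Psi> M tens_outer)
  next
    case False
    \<comment> \<open>Splitting into rows pairs the basis \<open>e 1\<close>, \<open>e 2\<close>
      with the rows of \<open>M\<close>, whose wedge is \<open>det M\<close>.\<close>
    have M: "M = outer (e 1) (M $ 1) + outer (e 2) (M $ 2)"
      by (simp add: outer_def vec_eq_iff forall_2 e_def axis_def)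
    have "\<Psi> = tprod3 u (e 1) (M $ 1) + tprod3 u (e 2) (M $ 2)"
      unfolding \<Psi> by (subst M) (simp add: tens_add_right tens_outer)
    moreover have "wedge (M $ 1) (M $ 2) \<noteq> 0"
      using False by (simp add: wedge_def det_2)
    ultimately show ?thesis using class_01I[OF u, of "e 1" "e 2" "M $ 1" "M $ 2"] by simp
  qed
qed

text \<open>All matrices of the pencil are singular, so the rank-one matrices \<open>M\<close>,
  \<open>N\<close> have dependent left or dependent right factors. A functional annihilating these
  contracts the second or the third tensor factor to zero.\<close>

lemma singular_pencil_degenerate:
  assumes "det M = 0" "det N = 0" "mixed_det M N = 0"
  shows "degenerate1 (swap12 (tens f M + tens g N)) \<or> degenerate1 (rotate3 (tens f M + tens g N))"
proof -
  obtain a b where M: "M = outer a b" using assms(1) by (rule det_eq_0_outerE)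
  obtain c d where N: "N = outer c d" using assms(2) by (rule det_eq_0_outerE)
  have "wedge a c * wedge b d = mixed_det M N"
    by (simp add: wedge_def mixed_det_def M N outer_def algebra_simps)
  with assms consider "wedge a c = 0" | "wedge b d = 0" by auto
  then show ?thesis
  proof cases
    case 1
    then obtain x :: "complex^2" where "x \<noteq> 0"
      and x: "x $ 1 * a $ 1 + x $ 2 * a $ 2 = 0" "x $ 1 * c $ 1 + x $ 2 * c $ 2 = 0"
      by (rule wedge_eq_0E)
    moreover have "contract x (swap12 (tens f M + tens g N)) = 0"
    proof -
      have "contract x (swap12 (tens f M + tens g N)) $ i $ k =
          f $ i * b $ k * (x $ 1 * a $ 1 + x $ 2 * a $ 2) + g $ i * d $ k * (x $ 1 * c $ 1 + x $ 2 * c $ 2)" for i k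
        by (simp add: contract_def swap12_def tens_def M N outer_def algebra_simps)
      then show ?thesis unfolding x by (simp add: vec_eq_iff)
    qed
    ultimately show ?thesis unfolding degenerate1_def by blast
  next
    case 2
    then obtain x :: "complex^2" where "x \<noteq> 0"
      and x: "x $ 1 * b $ 1 + x $ 2 * b $ 2 = 0" "x $ 1 * d $ 1 + x $ 2 * d $ 2 = 0"
      by (rule wedge_eq_0E)
    moreover have "contract x (rotate3 (tens f M + tens g N)) = 0"
    proof -
      have "contract x (rotate3 (tens f M + tens g N)) $ i $ k =
          f $ i * a $ k * (x $ 1 * b $ 1 + x $ 2 * b $ 2) + g $ i * c $ k * (x $ 1 * d $ 1 + x $ 2 * d $ 2)" for i k
        by (simp add: contract_def rotate3_def tens_def M N outer_def algebra_simps)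
      then show ?thesis unfolding x by (simp add: vec_eq_iff)
    qed
    ultimately show ?thesis unfolding degenerate1_def by blast
  qed
qed

section \<open>Nondegenerate tensors and the roots of the pencil form\<close>

lemma det_contract:
  "det (contract x \<Psi>) =
     det (\<Psi> $ 1) * (x $ 1)^2 + mixed_det (\<Psi> $ 1) (\<Psi> $ 2) * x $ 1 * x $ 2 + det (\<Psi> $ 2) * (x $ 2)^2"
  by (simp add: contract_def det_2 mixed_det_def power2_eq_square algebra_simps)

lemma quadratic_factor:
  fixes a b c t :: complex
  assumes "a \<noteq> 0"
  defines "s \<equiv> csqrt (b^2 - 4 * a * c)"
  shows "a * t^2 + b * t + c = a * (t - (- b + s) / (2 * a)) * (t - (- b - s) / (2 * a))"
proof -
  have s: "s^2 = b^2 - 4 * a * c" by (simp add: s_def)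
  \<comment> \<open>Multiplying by \<open>4 * a\<close> completes the square and gives a difference
    of squares.\<close>
  have "4 * a * (a * (t - (- b + s) / (2 * a)) * (t - (- b - s) / (2 * a))) =
      (2 * a * t + b)^2 - s^2"
    using assms(1) by (simp add: field_simps power2_eq_square)
  also have "\<dots> = 4 * a * (a * t^2 + b * t + c)"
    unfolding s by (simp add: power2_eq_square algebra_simps)
  finally show ?thesis using assms(1) by simp
qed

text \<open>The roots are projective, so that a vanishing leading coefficient only means a root at
  infinity.\<close>

lemma binary_quadratic_roots:
  fixes p m r :: complex
  obtains x y :: "complex^2" where "x \<noteq> 0" "m^2 - 4 * p * r \<noteq> 0 \<Longrightarrow> wedge x y \<noteq> 0"
    "p * (x $ 1)^2 + m * x $ 1 * x $ 2 + r * (x $ 2)^2 = 0"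
    "p * (y $ 1)^2 + m * y $ 1 * y $ 2 + r * (y $ 2)^2 = 0"
proof (cases "p = 0")
  case True
  \<comment> \<open>The form is now \<open>x2 * (m * x1 + r * x2)\<close>. The second root vector is
    zero when \<open>m = r = 0\<close>, which is why only \<open>x\<close> is claimed to be nonzero
    in general.\<close>
  show ?thesis
    by (rule that[of "vector [1, 0]" "vector [r, - m]"])
      (use True in \<open>auto simp: vec2_eq_0_iff wedge_def power2_eq_square algebra_simps\<close>)
next
  case False
  define s where "s = csqrt (m^2 - 4 * p * r)"
  let ?t = "(- m + s) / (2 * p)" and ?u = "(- m - s) / (2 * p)"
  have "p * ?t^2 + m * ?t + r = 0" "p * ?u^2 + m * ?u + r = 0"
    unfolding quadratic_factor[OF False, of _ m r, folded s_def] by simp_all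
  moreover have "s \<noteq> 0 \<Longrightarrow> ?t \<noteq> ?u"
    using False by simp
  moreover have "m^2 - 4 * p * r \<noteq> 0 \<Longrightarrow> s \<noteq> 0"
    by (simp add: s_def)
  ultimately show ?thesis
    by (intro that[of "vector [?t, 1]" "vector [?u, 1]"])
      (simp_all add: vec2_eq_0_iff wedge_def)
qed

lemma hyperdet_ne_0_class_GHZ:
  assumes "hyperdet \<Psi> \<noteq> 0"
  shows "\<Psi> \<in> class_GHZ"
proof -
  obtain x y where xy: "wedge x y \<noteq> 0" "det (contract x \<Psi>) = 0" "det (contract y \<Psi>) = 0"
    using assms unfolding hyperdet_def pencil_disc_def det_contract
    by (metis binary_quadratic_roots)
  obtain f g where \<Psi>: "\<Psi> = tens f (contract x \<Psi>) + tens g (contract y \<Psi>)"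
    using xy(1) by (metis tens_contract)
  obtain a b where "contract x \<Psi> = outer a b" using xy(2) by (rule det_eq_0_outerE)
  moreover obtain c d where "contract y \<Psi> = outer c d" using xy(3) by (rule det_eq_0_outerE)
  ultimately have \<Psi>: "\<Psi> = tens f (outer a b) + tens g (outer c d)" using \<Psi> by simp
  \<comment> \<open>The hyperdeterminant is the square of the product of these three wedges.\<close>
  have "wedge f g \<noteq> 0" "wedge a c \<noteq> 0" "wedge b d \<noteq> 0"
    using assms unfolding \<Psi> hyperdet_tens pencil_disc_outer by auto
  then show ?thesis
    unfolding class_GHZ_iff using \<Psi>[unfolded tens_outer] by blast
qed

text \<open>Cramer's rule expands each column of \<open>M\<close> in the basis \<open>c\<close>,
  \<open>c'\<close>.\<close>

lemma outer_decomposition: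
  assumes "wedge c c' \<noteq> 0"
  obtains u v where "M = outer c u + outer c' v"
proof
  let ?w = "wedge c c'"
  let ?u = "\<chi> k. (M $ 1 $ k * c' $ 2 - M $ 2 $ k * c' $ 1) / ?w"
  let ?v = "\<chi> k. (c $ 1 * M $ 2 $ k - c $ 2 * M $ 1 $ k) / ?w"
  have "?w * M $ j $ k = ?w * (outer c ?u + outer c' ?v) $ j $ k" for j k
    using exhaust_2[of j] assms
    by (elim disjE) (simp_all add: outer_def distrib_left, simp_all add: wedge_def algebra_simps)
  then show "M = outer c ?u + outer c' ?v"
    unfolding vec_eq_iff mult_left_cancel[OF assms] by blast
qed

lemma wedge_eq_0_scale:
  assumes "wedge d v = 0" "d \<noteq> 0"
  obtains t where "v = t *s d"
proof (cases "d $ 1 = 0")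
  case True
  then have "v = (v $ 2 / d $ 2) *s d"
    using assms by (auto simp: vec_eq_iff forall_2 wedge_def)
  then show ?thesis by (rule that)
next
  case False
  then have "v = (v $ 1 / d $ 1) *s d"
    using assms by (auto simp: vec_eq_iff forall_2 wedge_def field_simps)
  then show ?thesis by (rule that)
qed

lemma hyperdet_eq_0_class_W:
  assumes h: "hyperdet \<Psi> = 0"
    and nd: "\<not> degenerate1 \<Psi>" "\<not> degenerate1 (swap12 \<Psi>)" "\<not> degenerate1 (rotate3 \<Psi>)"
  shows "\<Psi> \<in> class_W"
proof -
  obtain x where x: "x \<noteq> 0" "det (contract x \<Psi>) = 0"
    unfolding det_contract by (metis binary_quadratic_roots)
  obtain y where y: "wedge x y \<noteq> 0" using exists_wedge_ne_0[OF x(1)] by blast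
  define M where "M = contract y \<Psi>"
  obtain f g where fg: "wedge f g \<noteq> 0" and \<Psi>: "\<Psi> = tens f (contract x \<Psi>) + tens g M"
    using y unfolding M_def by (metis tens_contract)
  obtain c d where cd: "contract x \<Psi> = outer c d" using x(2) by (rule det_eq_0_outerE)
  have \<Psi>: "\<Psi> = tens f (outer c d) + tens g M" using \<Psi> unfolding cd .
  have "outer c d \<noteq> 0" using nd(1) x cd unfolding degenerate1_def by metis
  then have c: "c \<noteq> 0" and d: "d \<noteq> 0" by (auto simp: outer_def vec_eq_iff)
  have det_cd: "det (outer c d) = 0" by (simp add: outer_def det_2)
  \<comment> \<open>With \<open>det (outer c d) = 0\<close> the discriminant is the square of the
    mixed term; its vanishing makes \<open>x\<close> a double root.\<close>
  have mixed: "mixed_det (outer c d) M = 0"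
    using h fg unfolding \<Psi> hyperdet_tens by (simp add: pencil_disc_def det_cd)
  \<comment> \<open>If \<open>M\<close> were singular too, the whole pencil would be, contradicting
    nondegeneracy in the second and third factors.\<close>
  have detM: "det M \<noteq> 0"
    using singular_pencil_degenerate[OF det_cd _ mixed] nd(2,3) \<Psi> by metis
  obtain c' where c': "wedge c c' \<noteq> 0" using exists_wedge_ne_0[OF c] by blast
  then obtain u v where M: "M = outer c u + outer c' v" by (rule outer_decomposition)
  \<comment> \<open>The mixed term sees only the \<open>c'\<close> part of \<open>M\<close>, so the
    double root forces \<open>v\<close> to be parallel to \<open>d\<close>.\<close>
  have "wedge c c' * wedge d v = mixed_det (outer c d) M"
    by (simp add: M mixed_det_def wedge_def outer_def algebra_simps)
  then have "wedge d v = 0" using mixed c' by simp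
  then obtain t where v: "v = t *s d" using d by (rule wedge_eq_0_scale)
  define a where "a = t *s c'"
  have M: "M = outer c u + outer a d"
    by (simp add: M v a_def outer_def vec_eq_iff algebra_simps)
  \<comment> \<open>Since \<open>M\<close> is invertible, this yields both bases required for the W
    form, in particular after absorbing \<open>t\<close> into \<open>a\<close>.\<close>
  have "det M = - (wedge c a * wedge d u)"
    by (simp add: M det_2 wedge_def outer_def algebra_simps)
  then have "wedge c a \<noteq> 0" "wedge d u \<noteq> 0" using detM by auto
  moreover have "wedge g f \<noteq> 0" using fg by (auto simp: wedge_def algebra_simps)
  moreover have "\<Psi> = tprod3 g c u + tprod3 g a d + tprod3 f c d"
    using \<Psi> by (simp add: M tens_add_right tens_outer add_ac)
  ultimately show ?thesis unfolding class_W_iff by blast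
qed

section \<open>Separation of the classes by degeneracy\<close>

text \<open>For an explicit tensor this turns degeneracy into a homogeneous linear system in two
  scalar unknowns.\<close>

lemma degenerate1_iff_coordinates:
  "degenerate1 \<Psi> \<longleftrightarrow> (\<exists>x y. (x \<noteq> 0 \<or> y \<noteq> 0) \<and> (\<forall>j k. x * \<Psi> $ 1 $ j $ k + y * \<Psi> $ 2 $ j $ k = 0))"
  (is "_ \<longleftrightarrow> ?R")
proof
  assume "degenerate1 \<Psi>"
  then obtain x where x: "x $ 1 \<noteq> 0 \<or> x $ 2 \<noteq> 0" "contract x \<Psi> = 0"
    by (auto simp: degenerate1_def vec2_eq_0_iff)
  then have "x $ 1 * \<Psi> $ 1 $ j $ k + x $ 2 * \<Psi> $ 2 $ j $ k = 0" for j k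
    by (simp add: contract_def vec_eq_iff)
  then show ?R using x(1) by blast
next
  assume ?R
  then obtain x y where "x \<noteq> 0 \<or> y \<noteq> 0" "\<forall>j k. x * \<Psi> $ 1 $ j $ k + y * \<Psi> $ 2 $ j $ k = 0"
    by blast
  then have "vector [x, y] \<noteq> (0 :: complex^2) \<and> contract (vector [x, y]) \<Psi> = 0"
    by (simp add: contract_def vec2_eq_0_iff)
  then show "degenerate1 \<Psi>" unfolding degenerate1_def by blast
qed

lemma degenerate1_product:
  "degenerate1 (tprod3 (e 1) (e 1) (e 1))"
  "degenerate1 (tprod3 (e 1) (e 1) (e 1) + tprod3 (e 1) (e 2) (e 2))"
  unfolding degenerate1_iff_coordinates
  \<comment> \<open>The functional \<open>(0, 1)\<close> annihilates \<open>e 1\<close>, the only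
    vector occurring in the first factor.\<close>
  by (rule exI[of _ 0], rule exI[of _ 1], simp add: forall_2 tprod3_def e_def axis_def)+

text \<open>With \<open>degenerate1_product\<close> this covers all six representatives, a list
  closed under \<open>swap12\<close> and \<open>rotate3\<close> up to the order of summands; so
  degeneracy in every factor is settled.\<close>

lemma not_degenerate1_canonical:
  "\<not> degenerate1 (tprod3 (e 1) (e 1) (e 1) + tprod3 (e 2) (e 1) (e 2))"
  "\<not> degenerate1 (tprod3 (e 1) (e 1) (e 1) + tprod3 (e 2) (e 2) (e 1))"
  "\<not> degenerate1 (tprod3 (e 1) (e 1) (e 1) + tprod3 (e 2) (e 2) (e 2))"
  "\<not> degenerate1 (tprod3 (e 1) (e 1) (e 2) + tprod3 (e 1) (e 2) (e 1) + tprod3 (e 2) (e 1) (e 1))"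
  unfolding degenerate1_iff_coordinates forall_2
  by (simp_all add: tprod3_def e_def axis_def)

lemmas slocc_degenerate1 =
  slocc_class_degenerate1
  slocc_class_swap[THEN slocc_class_degenerate1]
  slocc_class_rotate[THEN slocc_class_degenerate1]

lemmas tprod3_perm = swap12_add rotate3_add swap12_tprod3 rotate3_tprod3

lemma degenerate1_class_000:
  "\<Psi> \<in> class_000 \<Longrightarrow> degenerate1 \<Psi> \<and> degenerate1 (swap12 \<Psi>) \<and> degenerate1 (rotate3 \<Psi>)"
  unfolding class_000_def
  by (simp add: slocc_degenerate1 tprod3_perm degenerate1_product not_degenerate1_canonical)

lemma degenerate1_class_01:
  "\<Psi> \<in> class_01_Psi23 \<Longrightarrow> degenerate1 \<Psi> \<and> \<not> degenerate1 (swap12 \<Psi>) \<and> \<not> degenerate1 (rotate3 \<Psi>)"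
  unfolding class_01_Psi23_def
  by (simp add: slocc_degenerate1 tprod3_perm degenerate1_product not_degenerate1_canonical)

lemma degenerate1_class_02:
  "\<Psi> \<in> class_02_Psi13 \<Longrightarrow> \<not> degenerate1 \<Psi> \<and> degenerate1 (swap12 \<Psi>) \<and> \<not> degenerate1 (rotate3 \<Psi>)"
  unfolding class_02_Psi13_def
  by (simp add: slocc_degenerate1 tprod3_perm degenerate1_product not_degenerate1_canonical)

lemma degenerate1_class_03:
  "\<Psi> \<in> class_03_Psi12 \<Longrightarrow> \<not> degenerate1 \<Psi> \<and> \<not> degenerate1 (swap12 \<Psi>) \<and> degenerate1 (rotate3 \<Psi>)"
  unfolding class_03_Psi12_def
  by (simp add: slocc_degenerate1 tprod3_perm degenerate1_product not_degenerate1_canonical)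

lemma degenerate1_class_GHZ:
  "\<Psi> \<in> class_GHZ \<Longrightarrow> \<not> degenerate1 \<Psi> \<and> \<not> degenerate1 (swap12 \<Psi>) \<and> \<not> degenerate1 (rotate3 \<Psi>)"
  unfolding class_GHZ_def
  by (simp add: slocc_degenerate1 tprod3_perm degenerate1_product not_degenerate1_canonical)

lemma degenerate1_class_W:
  assumes "\<Psi> \<in> class_W"
  shows "\<not> degenerate1 \<Psi> \<and> \<not> degenerate1 (swap12 \<Psi>) \<and> \<not> degenerate1 (rotate3 \<Psi>)"
proof -
  let ?W = "tprod3 (e 1) (e 1) (e 2) + tprod3 (e 1) (e 2) (e 1) + tprod3 (e 2) (e 1) (e 1)"
  \<comment> \<open>The representative is symmetric, so its first factor decides for all
    three.\<close>
  have "swap12 ?W = ?W" "rotate3 ?W = ?W"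
    by (simp_all only: tprod3_perm add_ac)
  then show ?thesis
    using slocc_degenerate1[OF assms[unfolded class_W_def]] not_degenerate1_canonical(4) by simp
qed

lemma swap12_classes:
  "swap12 \<Psi> \<in> class_000 \<Longrightarrow> \<Psi> \<in> class_000"
  "swap12 \<Psi> \<in> class_01_Psi23 \<Longrightarrow> \<Psi> \<in> class_02_Psi13"
  unfolding class_000_def class_01_Psi23_def class_02_Psi13_def
  by (drule slocc_class_swap, simp add: tprod3_perm)+

lemma rotate3_classes:
  "rotate3 \<Psi> \<in> class_000 \<Longrightarrow> \<Psi> \<in> class_000"
  "rotate3 \<Psi> \<in> class_01_Psi23 \<Longrightarrow> \<Psi> \<in> class_03_Psi12"
  unfolding class_000_def class_01_Psi23_def class_03_Psi12_def
  \<comment> \<open>\<open>rotate3\<close> has order three, so two further rotations undo the given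
    one.\<close>
  by (drule slocc_class_rotate, drule slocc_class_rotate, simp add: tprod3_perm)+

text \<open>Every nonzero tensor degenerate in some factor lies in one of these four classes, and
  their degeneracy patterns are pairwise different.\<close>

lemma class_iff_degenerate1:
  assumes "\<Psi> \<noteq> 0"
  shows "\<Psi> \<in> class_000 \<longleftrightarrow> degenerate1 \<Psi> \<and> degenerate1 (swap12 \<Psi>) \<and> degenerate1 (rotate3 \<Psi>)"
    and "\<Psi> \<in> class_01_Psi23 \<longleftrightarrow> degenerate1 \<Psi> \<and> \<not> degenerate1 (swap12 \<Psi>) \<and> \<not> degenerate1 (rotate3 \<Psi>)"
    and "\<Psi> \<in> class_02_Psi13 \<longleftrightarrow> \<not> degenerate1 \<Psi> \<and> degenerate1 (swap12 \<Psi>) \<and> \<not> degenerate1 (rotate3 \<Psi>)"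
    and "\<Psi> \<in> class_03_Psi12 \<longleftrightarrow> \<not> degenerate1 \<Psi> \<and> \<not> degenerate1 (swap12 \<Psi>) \<and> degenerate1 (rotate3 \<Psi>)"
  using degenerate1_classes[of \<Psi>] degenerate1_classes[of "swap12 \<Psi>"] degenerate1_classes[of "rotate3 \<Psi>"]
    assms swap12_classes[of \<Psi>] rotate3_classes[of \<Psi>]
    degenerate1_class_000[of \<Psi>] degenerate1_class_01[of \<Psi>]
    degenerate1_class_02[of \<Psi>] degenerate1_class_03[of \<Psi>]
  by auto

lemma class_iff_hyperdet:
  shows "\<Psi> \<in> class_GHZ \<longleftrightarrow> \<not> degenerate1 \<Psi> \<and> \<not> degenerate1 (swap12 \<Psi>) \<and> \<not> degenerate1 (rotate3 \<Psi>)
      \<and> hyperdet \<Psi> \<noteq> 0"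
    and "\<Psi> \<in> class_W \<longleftrightarrow> \<not> degenerate1 \<Psi> \<and> \<not> degenerate1 (swap12 \<Psi>) \<and> \<not> degenerate1 (rotate3 \<Psi>)
      \<and> hyperdet \<Psi> = 0"
  using hyperdet_ne_0_class_GHZ hyperdet_eq_0_class_W hyperdet_class_GHZ hyperdet_class_W
    degenerate1_class_GHZ degenerate1_class_W by blast+

section \<open>Spectra and discriminants\<close>

lemma spectrum_2: "spectrum A = {l. l^2 - trace A * l + det A = 0}"
proof -
  have "l \<in> spectrum A \<longleftrightarrow> det (A - mat l) = 0" for l
  proof -
    have "A *v v = l *s v \<longleftrightarrow> (A - mat l) *v v = 0" for v
      by (auto simp: vec_eq_iff forall_2 matrix_vector_mult_def sum_2 mat_def algebra_simps)
    then have "l \<in> spectrum A \<longleftrightarrow> \<not> (\<forall>v. (A - mat l) *v v = 0 \<longrightarrow> v = 0)"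
      unfolding spectrum_def by auto
    also have "\<dots> \<longleftrightarrow> det (A - mat l) = 0"
      unfolding matrix_left_invertible_ker[symmetric] invertible_left_inverse[symmetric] invertible_det_nz
      by simp
    finally show ?thesis .
  qed
  moreover have "det (A - mat l) = l^2 - trace A * l + det A" for l
    by (simp add: det_2 trace_def sum_2 mat_def power2_eq_square algebra_simps)
  ultimately show ?thesis by auto
qed

text \<open>The eigenvalues are \<open>(trace A + s) / 2\<close> and
  \<open>(trace A - s) / 2\<close> for a square root \<open>s\<close> of the discriminant, and they
  coincide exactly when \<open>s = 0\<close>.\<close>

lemma spectrum_disc:
  shows "nondegenerate_spectrum A \<longleftrightarrow> trace A ^ 2 - 4 * det A \<noteq> 0"
    and "degenerate_spectrum A \<longleftrightarrow> trace A ^ 2 - 4 * det A = 0"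
proof -
  define s where "s = csqrt (trace A ^ 2 - 4 * det A)"
  have s: "s = 0 \<longleftrightarrow> trace A ^ 2 - 4 * det A = 0"
    by (simp add: s_def)
  have "spectrum A = {(trace A + s) / 2, (trace A - s) / 2}"
  proof -
    have "l^2 - trace A * l + det A = (l - (trace A + s) / 2) * (l - (trace A - s) / 2)" for l
      using quadratic_factor[of 1 l "- trace A" "det A"] by (simp add: s_def)
    then show ?thesis unfolding spectrum_2 by auto
  qed
  moreover have "(trace A + s) / 2 = (trace A - s) / 2 \<longleftrightarrow> s = 0"
    by (auto simp: field_simps)
  ultimately show "nondegenerate_spectrum A \<longleftrightarrow> trace A ^ 2 - 4 * det A \<noteq> 0"
    and "degenerate_spectrum A \<longleftrightarrow> trace A ^ 2 - 4 * det A = 0"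
    unfolding nondegenerate_spectrum_def degenerate_spectrum_def s[symmetric]
    by (metis doubleton_eq_iff insert_absorb2)+
qed

lemma pencil_disc_commute: "pencil_disc A B = pencil_disc B A"
  by (simp add: pencil_disc_def mixed_det_def algebra_simps)

text \<open>Writing \<open>B = A ** X\<close> factors the pencil form as \<open>det A\<close> times
  \<open>det (x I + y X)\<close>, whose discriminant is that of the characteristic polynomial of
  \<open>X\<close>.\<close>

lemma pencil_disc_spectrum:
  assumes "det A \<noteq> 0"
  shows "nondegenerate_spectrum (matrix_inv A ** B) \<longleftrightarrow> pencil_disc A B \<noteq> 0"
    and "degenerate_spectrum (matrix_inv A ** B) \<longleftrightarrow> pencil_disc A B = 0"
proof -
  define X where "X = matrix_inv A ** B"
  have B: "B = A ** X"
    using assms by (simp add: X_def matrix_mul_assoc matrix_inv_right invertible_det_nz)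
  have "mixed_det A B = det A * trace X"
    by (simp add: B mixed_det_def matrix_matrix_mult_def sum_2 det_2 trace_def algebra_simps)
  then have "pencil_disc A B = det A ^ 2 * (trace X ^ 2 - 4 * det X)"
    by (simp add: pencil_disc_def B det_mul power2_eq_square algebra_simps)
  then show "nondegenerate_spectrum (matrix_inv A ** B) \<longleftrightarrow> pencil_disc A B \<noteq> 0"
    and "degenerate_spectrum (matrix_inv A ** B) \<longleftrightarrow> pencil_disc A B = 0"
    using assms by (simp_all add: spectrum_disc flip: X_def)
qed

section \<open>Singular value decompositions and the pencil of slices\<close>

text \<open>Each singular value contributes one product. \<open>assoc_matrix\<close> stores the
  coordinate of the pair \<open>(j, k)\<close> at position \<open>(k, j)\<close> and the
  decomposition uses the conjugate of \<open>W\<close>; hence the conjugate transposes.\<close>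

lemma svd_decomposition:
  assumes "is_svd (C1 \<Psi>) V s1 s2 W"
  shows "\<Psi> = tens (of_real s1 *s column 1 V) (conj_transpose (assoc_matrix (column 1 W)))
           + tens (of_real s2 *s column 2 V) (conj_transpose (assoc_matrix (column 2 W)))"
proof -
  have C: "C1 \<Psi> $ i $ l = V $ i $ 1 * of_real s1 * cnj (W $ l $ 1) + V $ i $ 2 * of_real s2 * cnj (W $ l $ 2)" for i l
    using assms by (simp add: is_svd_def matrix_matrix_mult_def sum_2 sum_4 conj_transpose_def)
  show ?thesis
    using C[of 1 1] C[of 1 2] C[of 1 3] C[of 1 4] C[of 2 1] C[of 2 2] C[of 2 3] C[of 2 4]
    by (simp add: vec_eq_iff forall_2 C1_def tens_def conj_transpose_def assoc_matrix_def column_def algebra_simps)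
qed

lemma unitary_column_ne_0: "unitary U \<Longrightarrow> column i U \<noteq> 0"
proof
  assume U: "unitary U" and c: "column i U = 0"
  \<comment> \<open>This diagonal entry is the squared norm of the column, which unitarity makes
    1.\<close>
  have "(conj_transpose U ** U) $ i $ i = 0"
    using c by (simp add: matrix_matrix_mult_def column_def vec_eq_iff)
  then show False using U by (simp add: unitary_def mat_def)
qed

lemma assoc_matrix_eq_0_iff: "assoc_matrix w = 0 \<longleftrightarrow> w = 0"
  by (auto simp: vec_eq_iff forall_2 forall_4 assoc_matrix_def)

text \<open>Conjugate transposition merely conjugates the coefficients of the pencil form, so the
  vanishing of its discriminant can be tested on \<open>W1\<close>, \<open>W2\<close>.\<close>

lemma conj_transpose_invariants:
  "det (conj_transpose A) = cnj (det A)"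
  "mixed_det (conj_transpose A) (conj_transpose B) = cnj (mixed_det A B)"
  for A B :: "complex^2^2"
  by (simp_all add: conj_transpose_def det_2 mixed_det_def algebra_simps)

lemma svd_criterion:
  assumes svd: "is_svd (C1 \<Psi>) V s1 s2 W"
    and nd: "\<not> degenerate1 \<Psi>" "\<not> degenerate1 (swap12 \<Psi>)" "\<not> degenerate1 (rotate3 \<Psi>)"
  defines "W1 \<equiv> assoc_matrix (column 1 W)" and "W2 \<equiv> assoc_matrix (column 2 W)"
  shows "hyperdet \<Psi> \<noteq> 0 \<longleftrightarrow> (rank W1 = 1 \<and> rank W2 = 1) \<or>
             (rank W1 = 2 \<and> rank W2 = 1 \<and> nondegenerate_spectrum (matrix_inv W1 ** W2)) \<or>
             (rank W2 = 2 \<and> rank W1 = 1 \<and> nondegenerate_spectrum (matrix_inv W2 ** W1)) \<or>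
             (rank W1 = 2 \<and> rank W2 = 2 \<and> nondegenerate_spectrum (matrix_inv W1 ** W2))"
    and "hyperdet \<Psi> = 0 \<longleftrightarrow>
             (rank W1 = 2 \<and> rank W2 = 1 \<and> degenerate_spectrum (matrix_inv W1 ** W2)) \<or>
             (rank W1 = 1 \<and> rank W2 = 2 \<and> degenerate_spectrum (matrix_inv W2 ** W1)) \<or>
             (rank W1 = 2 \<and> rank W2 = 2 \<and> degenerate_spectrum (matrix_inv W1 ** W2))"
proof -
  define f where "f = of_real s1 *s column 1 V"
  define g where "g = of_real s2 *s column 2 V"
  have \<Psi>: "\<Psi> = tens f (conj_transpose W1) + tens g (conj_transpose W2)"
    using svd_decomposition[OF svd] unfolding f_def g_def W1_def W2_def .
  have "s1 > 0" "s2 > 0"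
    \<comment> \<open>Positive singular values together with the invertible \<open>V\<close> make
      \<open>f\<close>, \<open>g\<close> a basis.\<close>
    using is_svd_rank_2_pos[OF svd] nd(1) by (simp_all add: rank_C1_eq_2_iff)
  moreover have "det V \<noteq> 0"
    using svd unfolding is_svd_def unitary_def by (metis invertible_def invertible_det_nz)
  moreover have "wedge f g = of_real s1 * of_real s2 * det V"
    by (simp add: f_def g_def wedge_def det_2 column_def algebra_simps)
  ultimately have fg: "wedge f g \<noteq> 0" by simp
  have "hyperdet \<Psi> = wedge f g ^ 2 * cnj (pencil_disc W1 W2)"
    unfolding \<Psi> hyperdet_tens by (simp add: pencil_disc_def conj_transpose_invariants)
  then have h: "hyperdet \<Psi> = 0 \<longleftrightarrow> pencil_disc W1 W2 = 0" using fg by simp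
  have "W1 \<noteq> 0" "W2 \<noteq> 0"
    using svd unitary_column_ne_0 by (auto simp: W1_def W2_def assoc_matrix_eq_0_iff is_svd_def)
  \<comment> \<open>Columns of a unitary matrix are nonzero, which excludes rank 0.\<close>
  then have r: "rank W1 = 1 \<longleftrightarrow> det W1 = 0" "rank W2 = 1 \<longleftrightarrow> det W2 = 0"
    using rank_le_2[of W1] rank_le_2[of W2] rank_eq_0_iff[of W1] rank_eq_0_iff[of W2]
      rank_eq_2_iff_det[of W1] rank_eq_2_iff_det[of W2] by linarith+
  \<comment> \<open>With both matrices singular there is no inverse whose spectrum could be tested.
    Nondegeneracy of \<open>\<Psi>\<close> then forces a nonzero discriminant, so this case belongs
    to GHZ alone.\<close>
  have both: "pencil_disc W1 W2 \<noteq> 0" if "det W1 = 0" "det W2 = 0"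
  proof
    assume "pencil_disc W1 W2 = 0"
    then have "mixed_det W1 W2 = 0" using that by (simp add: pencil_disc_def)
    then show False
      using singular_pencil_degenerate[of "conj_transpose W1" "conj_transpose W2" f g] that nd \<Psi>
      by (simp add: conj_transpose_invariants)
  qed
  show "hyperdet \<Psi> \<noteq> 0 \<longleftrightarrow> (rank W1 = 1 \<and> rank W2 = 1) \<or>
             (rank W1 = 2 \<and> rank W2 = 1 \<and> nondegenerate_spectrum (matrix_inv W1 ** W2)) \<or>
             (rank W2 = 2 \<and> rank W1 = 1 \<and> nondegenerate_spectrum (matrix_inv W2 ** W1)) \<or>
             (rank W1 = 2 \<and> rank W2 = 2 \<and> nondegenerate_spectrum (matrix_inv W1 ** W2))"
   and "hyperdet \<Psi> = 0 \<longleftrightarrow>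
             (rank W1 = 2 \<and> rank W2 = 1 \<and> degenerate_spectrum (matrix_inv W1 ** W2)) \<or>
             (rank W1 = 1 \<and> rank W2 = 2 \<and> degenerate_spectrum (matrix_inv W2 ** W1)) \<or>
             (rank W1 = 2 \<and> rank W2 = 2 \<and> degenerate_spectrum (matrix_inv W1 ** W2))"
    \<comment> \<open>In the other cases the spectrum is taken with an invertible matrix of the
      pair; symmetry of the discriminant covers the case where this is \<open>W2\<close>.\<close>
    unfolding h r rank_eq_2_iff_det
    using both pencil_disc_spectrum[of W1 W2] pencil_disc_spectrum[of W2 W1]
      pencil_disc_commute[of W1 W2] by auto
qed

theorem mainTheorem2:
  fixes \<Psi> :: tensor3
  assumes "\<Psi> \<noteq> 0"
  shows
    "(\<Psi> \<in> class_000 \<longleftrightarrow> rank (C1 \<Psi>) = 1 \<and> rank (C2 \<Psi>) = 1 \<and> rank (C3 \<Psi>) = 1) \<and>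
     (\<Psi> \<in> class_01_Psi23 \<longleftrightarrow> rank (C1 \<Psi>) = 1 \<and> rank (C2 \<Psi>) = 2 \<and> rank (C3 \<Psi>) = 2) \<and>
     (\<Psi> \<in> class_02_Psi13 \<longleftrightarrow> rank (C2 \<Psi>) = 1 \<and> rank (C1 \<Psi>) = 2 \<and> rank (C3 \<Psi>) = 2) \<and>
     (\<Psi> \<in> class_03_Psi12 \<longleftrightarrow> rank (C3 \<Psi>) = 1 \<and> rank (C1 \<Psi>) = 2 \<and> rank (C2 \<Psi>) = 2) \<and>
     (\<forall>V s1 s2 W. is_svd (C1 \<Psi>) V s1 s2 W \<longrightarrow>
       (let W1 = assoc_matrix (column 1 W); W2 = assoc_matrix (column 2 W) in
         (\<Psi> \<in> class_GHZ \<longleftrightarrow>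
            (rank (C1 \<Psi>) = 2 \<and> rank (C2 \<Psi>) = 2 \<and> rank (C3 \<Psi>) = 2) \<and>
            ((rank W1 = 1 \<and> rank W2 = 1) \<or>
             (rank W1 = 2 \<and> rank W2 = 1 \<and> nondegenerate_spectrum (matrix_inv W1 ** W2)) \<or>
             (rank W2 = 2 \<and> rank W1 = 1 \<and> nondegenerate_spectrum (matrix_inv W2 ** W1)) \<or>
             (rank W1 = 2 \<and> rank W2 = 2 \<and> nondegenerate_spectrum (matrix_inv W1 ** W2)))) \<and>
         (\<Psi> \<in> class_W \<longleftrightarrow>
            (rank (C1 \<Psi>) = 2 \<and> rank (C2 \<Psi>) = 2 \<and> rank (C3 \<Psi>) = 2) \<and>
            ((rank W1 = 2 \<and> rank W2 = 1 \<and> degenerate_spectrum (matrix_inv W1 ** W2)) \<or>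
             (rank W1 = 1 \<and> rank W2 = 2 \<and> degenerate_spectrum (matrix_inv W2 ** W1)) \<or>
             (rank W1 = 2 \<and> rank W2 = 2 \<and> degenerate_spectrum (matrix_inv W1 ** W2))))))"
proof -
  \<comment> \<open>Ranks are translated into degeneracy of the permuted tensors, the terms in which
    the classes have been characterised.\<close>
  have r1: "rank (C1 \<Psi>) = 1 \<longleftrightarrow> degenerate1 \<Psi>" "rank (C2 \<Psi>) = 1 \<longleftrightarrow> degenerate1 (swap12 \<Psi>)"
      "rank (C3 \<Psi>) = 1 \<longleftrightarrow> degenerate1 (rotate3 \<Psi>)"
    using assms by (simp_all add: C2_conv_C1 C3_conv_C1 rank_C1_eq_1_iff del: One_nat_def)
  have r2: "rank (C1 \<Psi>) = 2 \<longleftrightarrow> \<not> degenerate1 \<Psi>" "rank (C2 \<Psi>) = 2 \<longleftrightarrow> \<not> degenerate1 (swap12 \<Psi>)"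
      "rank (C3 \<Psi>) = 2 \<longleftrightarrow> \<not> degenerate1 (rotate3 \<Psi>)"
    by (simp_all add: C2_conv_C1 C3_conv_C1 rank_C1_eq_2_iff)
  show ?thesis
    unfolding r1 r2 Let_def
    using class_iff_degenerate1[OF assms] class_iff_hyperdet[of \<Psi>] svd_criterion[of \<Psi>]
    by (intro conjI allI impI) blast+
qed

end
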